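(* Let $(X,p)$ be a partial metric space, let $\mathcal{I}$ be a non-trivial admissible ideal of $\mathbb{N}$, let $\{\xi_n\}$ be a sequence in $X$ and let $r>0$ be any real number. If $\{\xi_n\}$ has a subsequence $\{\xi_{i_k}\}_{k\in\mathbb{N}}$ (with $i_1<i_2<\cdots$) satisfying $\mathcal{I}\text{-}\lim_{n\to\infty}\frac{1}{n}|\{i_k\le n:k\in\mathbb{N}\}|=1$, then $\mathcal{I}\text{-}st\text{-}LIM^{r}\xi_n\subseteq\mathcal{I}\text{-}st\text{-}LIM^{r}\xi_{i_k}$, where the right-hand side is the rough $\mathcal{I}$-statistical limit set of the sequence $k\mapsto\xi_{i_k}$.
   Context: A partial metric on a non-empty set $X$ is a function $p:X\times X\to[0,\infty)$ such that for all $x,y,z\in X$: (p1) $0\le p(x,x)\le p(x,y)$; (p2) $x=y$ if and only if $p(x,x)=p(x,y)=p(y,y)$; (p3) $p(x,y)=p(y,x)$; (p4) $p(x,y)\le p(x,z)+p(z,y)-p(z,z)$. Then $(X,p)$ is called a partial metric space. An ideal of $\mathbb{N}$ is a family $\mathcal{I}\subset 2^{\mathbb{N}}$ containing $\emptyset$, closed under finite unions and under taking subsets; it is non-trivial if $\mathcal{I}\ne 2^{\mathbb{N}}$ and $\mathcal{I}\neq\{\emptyset\}$, and a non-trivial ideal is admissible if $\{n\}\in\mathcal{I}$ for every $n\in\mathbb{N}$. For a real sequence $\{x_n\}$, $\mathcal{I}\text{-}\lim_{n\to\infty} x_n=x$ means that for every $\varepsilon>0$, $\{n\in\mathbb{N}:|x_n-x|\ge\varepsilon\}\in\mathcal{I}$.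 A sequence $\{\xi_n\}$ in $X$ is rough $\mathcal{I}$-statistically convergent to $\xi\in X$ of roughness degree $r\ge 0$ if for every $\varepsilon>0$ and $\delta>0$, $\left\{n\in\mathbb{N}:\frac{1}{n}\left|\{k\le n:|p(\xi_k,\xi)-p(\xi,\xi)|\ge r+\varepsilon\}\right|\ge\delta\right\}\in\mathcal{I}$. The set of all such $\xi\in X$ is the rough $\mathcal{I}$-statistical limit set, denoted $\mathcal{I}\text{-}st\text{-}LIM^{r}\xi_n$. *)

theory Defs
  imports Complex_Main
begin

(* The index set of all sequences and ideals below is the set of positive integers, so that
   1/n makes sense; the value of a sequence at 0 is never used. *)
abbreviation Npos :: "nat set" where
  "Npos \<equiv> {1..}"

locale partial_metric_space =
  fixes X :: "'a set" and p :: "'a \<Rightarrow> 'a \<Rightarrow> real"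
  assumes nonempty: "X \<noteq> {}"
    and nonneg: "\<lbrakk>x \<in> X; y \<in> X\<rbrakk> \<Longrightarrow> 0 \<le> p x y"
    and p1: "\<lbrakk>x \<in> X; y \<in> X\<rbrakk> \<Longrightarrow> 0 \<le> p x x \<and> p x x \<le> p x y"
    and p2: "\<lbrakk>x \<in> X; y \<in> X\<rbrakk> \<Longrightarrow> x = y \<longleftrightarrow> p x x = p x y \<and> p x y = p y y"
    and p3: "\<lbrakk>x \<in> X; y \<in> X\<rbrakk> \<Longrightarrow> p x y = p y x"
    and p4: "\<lbrakk>x \<in> X; y \<in> X; z \<in> X\<rbrakk> \<Longrightarrow> p x y \<le> p x z + p z y - p z z"

definition set_ideal :: "nat set set \<Rightarrow> bool" where
  "set_ideal I \<longleftrightarrow> I \<subseteq> Pow Npos \<and> {} \<in> I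
     \<and> (\<forall>A\<in>I. \<forall>B\<in>I. A \<union> B \<in> I) \<and> (\<forall>A\<in>I. \<forall>B. B \<subseteq> A \<longrightarrow> B \<in> I)"

definition nontrivial_ideal :: "nat set set \<Rightarrow> bool" where
  "nontrivial_ideal I \<longleftrightarrow> set_ideal I \<and> I \<noteq> Pow Npos \<and> I \<noteq> {{}}"

definition admissible_ideal :: "nat set set \<Rightarrow> bool" where
  "admissible_ideal I \<longleftrightarrow> nontrivial_ideal I \<and> (\<forall>n\<in>Npos. {n} \<in> I)"

definition ideal_tendsto :: "nat set set \<Rightarrow> (nat \<Rightarrow> real) \<Rightarrow> real \<Rightarrow> bool" where
  "ideal_tendsto I x l \<longleftrightarrow> (\<forall>\<epsilon>>0. {n \<in> Npos. \<bar>x n - l\<bar> \<ge> \<epsilon>} \<in> I)"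

definition rough_ideal_stat_convergent ::
  "('a \<Rightarrow> 'a \<Rightarrow> real) \<Rightarrow> nat set set \<Rightarrow> real \<Rightarrow> (nat \<Rightarrow> 'a) \<Rightarrow> 'a \<Rightarrow> bool" where
  "rough_ideal_stat_convergent p I r \<xi> l \<longleftrightarrow>
     (\<forall>\<epsilon>>0. \<forall>\<delta>>0.
        {n \<in> Npos. 1 / real n * real (card {k \<in> Npos. k \<le> n \<and> \<bar>p (\<xi> k) l - p l l\<bar> \<ge> r + \<epsilon>}) \<ge> \<delta>} \<in> I)"

definition rough_ideal_stat_LIM ::
  "'a set \<Rightarrow> ('a \<Rightarrow> 'a \<Rightarrow> real) \<Rightarrow> nat set set \<Rightarrow> real \<Rightarrow> (nat \<Rightarrow> 'a) \<Rightarrow> 'a set" where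
  "rough_ideal_stat_LIM X p I r \<xi> = {l \<in> X. rough_ideal_stat_convergent p I r \<xi> l}"

end

theory Submission
  imports Defs
begin

(* An index k \<le> n whose term is far from the limit either has i k \<le> n, so that i k is counted
   among the far terms of the full sequence up to n, or has n < i k; the indices of the second kind
   number n - |{i k. k} \<inter> {1..n}|, which is negligible because the range of i has I-density 1. *)

lemma strict_mono_on_Npos_le:
  fixes i :: "nat \<Rightarrow> nat"
  assumes "strict_mono_on Npos i" and "i ` Npos \<subseteq> Npos" and "k \<in> Npos"
  shows "k \<le> i k"
proof -
  have "1 \<le> k" using assms(3) by simp
  then show ?thesis
  proof (induction k rule: dec_induct)
    case base
    then show ?case using assms(2) by auto
  next
    case (step n)
    then have "i n < i (Suc n)"
      using assms(1) by (auto dest: strict_mono_onD)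
    with step.IH show ?case by simp
  qed
qed

text \<open>Indices with \<open>i k \<le> n\<close> are carried injectively by \<open>i\<close> to
  positions up to \<open>n\<close> satisfying \<open>P\<close>. The remaining indices up to
  \<open>n\<close> number at most \<open>n\<close> minus the count of range elements up to
  \<open>n\<close>. That count stands on the left, so that no truncated subtraction on
  \<open>nat\<close> occurs.\<close>

lemma card_subseq_le:
  fixes i :: "nat \<Rightarrow> nat"
  assumes mono: "strict_mono_on Npos i" and pos: "i ` Npos \<subseteq> Npos"
  shows "card {k \<in> Npos. k \<le> n \<and> P (i k)} + card {m. m \<le> n \<and> m \<in> i ` Npos}
         \<le> card {m \<in> Npos. m \<le> n \<and> P m} + n"
proof -
  let ?L = "{k \<in> Npos. k \<le> n \<and> i k \<le> n}"
  let ?H = "{k \<in> Npos. k \<le> n \<and> n < i k}"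
  have inj: "inj_on i Npos"
    using mono by (rule strict_mono_on_imp_inj_on)
  \<comment> \<open>Since \<open>k \<le> i k\<close>, a value \<open>i k \<le> n\<close> comes from
    an index \<open>k \<le> n\<close>, that is, from \<open>?L\<close>.\<close>
  have "{m. m \<le> n \<and> m \<in> i ` Npos} \<subseteq> i ` ?L"
    using strict_mono_on_Npos_le[OF mono pos] by fastforce
  then have "card {m. m \<le> n \<and> m \<in> i ` Npos} \<le> card ?L"
    by (intro surj_card_le) auto
  moreover have "card ?L + card ?H = n"
  proof -
    have "?L \<union> ?H = {1..n}" by auto
    moreover have "card (?L \<union> ?H) = card ?L + card ?H"
      by (rule card_Un_disjoint) auto
    ultimately show ?thesis by simp
  qed
  \<comment> \<open>On \<open>?H\<close> the position \<open>i k\<close> lies beyond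
    \<open>n\<close>, where the count of \<open>P\<close> up to \<open>n\<close> gives no control,
    so all of \<open>?H\<close> is included in the bound.\<close>
  moreover have "card {k \<in> Npos. k \<le> n \<and> P (i k)} \<le> card ({k \<in> ?L. P (i k)} \<union> ?H)"
    by (rule card_mono) auto
  moreover have "card ({k \<in> ?L. P (i k)} \<union> ?H) \<le> card {k \<in> ?L. P (i k)} + card ?H"
    by (rule card_Un_le)
  moreover have "card {k \<in> ?L. P (i k)} \<le> card {m \<in> Npos. m \<le> n \<and> P m}"
  proof (rule card_inj_on_le)
    show "inj_on i {k \<in> ?L. P (i k)}"
      using inj by (rule inj_on_subset) auto
    show "i ` {k \<in> ?L. P (i k)} \<subseteq> {m \<in> Npos. m \<le> n \<and> P m}"
      using pos by auto
  qed auto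
  ultimately show ?thesis by linarith
qed

text \<open>The exceptional set is covered by two members of \<open>I\<close>, one given by
  \<open>null\<close> and one by \<open>dense\<close>, each taken at threshold
  \<open>\<delta> / 2\<close>. The predicate \<open>P\<close> stays abstract, as the argument only
  counts indices.\<close>

lemma ideal_density_zero_subseq:
  fixes i :: "nat \<Rightarrow> nat"
  assumes I: "set_ideal I"
    and mono: "strict_mono_on Npos i" and pos: "i ` Npos \<subseteq> Npos"
    and dense: "ideal_tendsto I (\<lambda>n. 1 / real n * real (card {m. m \<le> n \<and> m \<in> i ` Npos})) 1"
    and null: "\<And>\<delta>. \<delta> > 0 \<Longrightarrow>
      {n \<in> Npos. 1 / real n * real (card {m \<in> Npos. m \<le> n \<and> P m}) \<ge> \<delta>} \<in> I"
    and "\<delta> > 0"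
  shows "{n \<in> Npos. 1 / real n * real (card {k \<in> Npos. k \<le> n \<and> P (i k)}) \<ge> \<delta>} \<in> I"
    (is "?S \<in> I")
proof -
  let ?B = "\<lambda>n. 1 / real n * real (card {m \<in> Npos. m \<le> n \<and> P m})"
  let ?A = "\<lambda>n. 1 / real n * real (card {m. m \<le> n \<and> m \<in> i ` Npos})"
  have "\<delta> / 2 > 0" using \<open>\<delta> > 0\<close> by simp
  then have "{n \<in> Npos. ?B n \<ge> \<delta> / 2} \<union> {n \<in> Npos. \<bar>?A n - 1\<bar> \<ge> \<delta> / 2} \<in> I"
    using I null dense unfolding set_ideal_def ideal_tendsto_def by blast
  moreover have "?S \<subseteq> {n \<in> Npos. ?B n \<ge> \<delta> / 2} \<union> {n \<in> Npos. \<bar>?A n - 1\<bar> \<ge> \<delta> / 2}"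
  proof
    fix n assume n: "n \<in> ?S"
    let ?C = "1 / real n * real (card {k \<in> Npos. k \<le> n \<and> P (i k)})"
    have "real n > 0" using n by auto
    have "real (card {k \<in> Npos. k \<le> n \<and> P (i k)}) + real (card {m. m \<le> n \<and> m \<in> i ` Npos})
        \<le> real (card {m \<in> Npos. m \<le> n \<and> P m}) + real n"
      using card_subseq_le[OF mono pos, of n P] by linarith
    from divide_right_mono[OF this, of "real n"] have "?C + ?A n \<le> ?B n + 1"
      using \<open>real n > 0\<close> by (simp add: add_divide_distrib)
    moreover have "\<delta> \<le> ?C" using n by blast
    \<comment> \<open>Here \<open>\<delta> \<le> ?B n + (1 - ?A n)\<close>, so at least one of the
      two summands reaches \<open>\<delta> / 2\<close>.\<close>
    ultimately have "?B n \<ge> \<delta> / 2 \<or> \<bar>?A n - 1\<bar> \<ge> \<delta> / 2" by argo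
    then show "n \<in> {n \<in> Npos. ?B n \<ge> \<delta> / 2} \<union> {n \<in> Npos. \<bar>?A n - 1\<bar> \<ge> \<delta> / 2}"
      using n by blast
  qed
  ultimately show ?thesis
    using I unfolding set_ideal_def by blast
qed

theorem theorem3p6:
  fixes X :: "'a set" and p :: "'a \<Rightarrow> 'a \<Rightarrow> real" and I :: "nat set set"
    and \<xi> :: "nat \<Rightarrow> 'a" and r :: real and i :: "nat \<Rightarrow> nat"
  assumes "partial_metric_space X p"
    and "admissible_ideal I"
    and "\<And>n. n \<in> Npos \<Longrightarrow> \<xi> n \<in> X"
    and "r > 0"
    and "\<And>k. k \<in> Npos \<Longrightarrow> i k \<in> Npos"
    and "strict_mono_on Npos i"
    and "ideal_tendsto I (\<lambda>n. 1 / real n * real (card {m. m \<le> n \<and> (\<exists>k\<in>Npos. m = i k)})) 1"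
  shows "rough_ideal_stat_LIM X p I r \<xi> \<subseteq> rough_ideal_stat_LIM X p I r (\<lambda>k. \<xi> (i k))"
proof
  fix l assume l: "l \<in> rough_ideal_stat_LIM X p I r \<xi>"
  have I: "set_ideal I"
    using assms(2) by (simp add: admissible_ideal_def nontrivial_ideal_def)
  have pos: "i ` Npos \<subseteq> Npos"
    using assms(5) by blast
  have dense: "ideal_tendsto I (\<lambda>n. 1 / real n * real (card {m. m \<le> n \<and> m \<in> i ` Npos})) 1"
    using assms(7) by (simp only: image_iff)
  \<comment> \<open>The predicate \<open>P m\<close> is
    \<open>\<bar>p (\<xi> m) l - p l l\<bar> \<ge> r + \<epsilon>\<close>. The same \<open>P\<close>
    serves for the sequence and the subsequence, so the roughness degree \<open>r\<close> does not
    grow.\<close>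
  have "{n \<in> Npos. 1 / real n *
      real (card {k \<in> Npos. k \<le> n \<and> \<bar>p (\<xi> (i k)) l - p l l\<bar> \<ge> r + \<epsilon>}) \<ge> \<delta>} \<in> I"
    if "\<epsilon> > 0" and "\<delta> > 0" for \<epsilon> \<delta>
    using l that
    by (intro ideal_density_zero_subseq[OF I assms(6) pos dense])
      (auto simp: rough_ideal_stat_LIM_def rough_ideal_stat_convergent_def)
  with l show "l \<in> rough_ideal_stat_LIM X p I r (\<lambda>k. \<xi> (i k))"
    by (simp add: rough_ideal_stat_LIM_def rough_ideal_stat_convergent_def)
qed

end
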